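(* Let $d,M\ge 1$, let $X\in\mathbb{R}^{d\times M}$ have pairwise distinct columns, and let $Z\in\mathbb{R}^{1\times M}$. Let $\sigma:\mathbb{R}\to\mathbb{R}$ be any continuous function that is not mean-periodic. Take network width $N=M$. Then there exist parameters $u_1\in\mathbb{R}^{N}$, $v_1\in\mathbb{R}^d$, $b_1\in\mathbb{R}^N$, $v_2\in\mathbb{R}^N$ such that $$v_2^T\,\sigma\big(u_1v_1^TX+b_1\mathbf{1}_M^T\big)=Z .$$
   Context: $\mathbf{1}_M\in\mathbb{R}^M$ is the column vector of ones, and $\sigma$ is applied entrywise to matrices. A continuous function $f:\mathbb{R}\to\mathbb{C}$ is called mean-periodic if there exists a nonzero compactly supported signed Borel measure $\mu$ on $\mathbb{R}$ such that $f*\mu=0$, i.e. $\int_{-\infty}^{+\infty}f(x-t)\,d\mu(t)=0$ for all $x\in\mathbb{R}$. *)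

theory Defs
  imports "HOL-Analysis.Analysis"
begin

section \<open>Signed Borel measures on the real line\<close>

text \<open>
  Values on non-Borel sets are irrelevant. As the values are real, such a set function
  automatically has finite total variation.
\<close>

definition signed_borel_measure :: "(real set \<Rightarrow> real) \<Rightarrow> bool" where
  "signed_borel_measure \<mu> \<longleftrightarrow>
     \<mu> {} = 0 \<and>
     (\<forall>A :: nat \<Rightarrow> real set. range A \<subseteq> sets borel \<longrightarrow> disjoint_family A \<longrightarrow>
        (\<lambda>i. \<mu> (A i)) sums \<mu> (\<Union>i. A i))"

definition compactly_supported_measure :: "(real set \<Rightarrow> real) \<Rightarrow> bool" where
  "compactly_supported_measure \<mu> \<longleftrightarrow>
     (\<exists>K. compact K \<and> (\<forall>A\<in>sets borel. A \<inter> K = {} \<longrightarrow> \<mu> A = 0))"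

definition nonzero_measure :: "(real set \<Rightarrow> real) \<Rightarrow> bool" where
  "nonzero_measure \<mu> \<longleftrightarrow> (\<exists>A\<in>sets borel. \<mu> A \<noteq> 0)"

text \<open>
  The positive part of the Jordan decomposition,
  \<open>\<mu>\<^sup>+(A) = sup {\<mu>(B) | B \<subseteq> A Borel}\<close>; the negative part is the positive part of \<open>-\<mu>\<close>.
  Since \<open>ennreal\<close> maps negative reals to \<open>0\<close> and \<open>B = {}\<close> is admitted, clipping is harmless.
\<close>

definition pos_part_value :: "(real set \<Rightarrow> real) \<Rightarrow> real set \<Rightarrow> ennreal" where
  "pos_part_value \<mu> A = (SUP B\<in>{B \<in> sets borel. B \<subseteq> A}. ennreal (\<mu> B))"

definition pos_part_measure :: "(real set \<Rightarrow> real) \<Rightarrow> real measure" where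
  "pos_part_measure \<mu> = measure_of UNIV (sets borel) (pos_part_value \<mu>)"

definition signed_integral :: "(real set \<Rightarrow> real) \<Rightarrow> (real \<Rightarrow> complex) \<Rightarrow> complex" where
  "signed_integral \<mu> g =
     integral\<^sup>L (pos_part_measure \<mu>) g - integral\<^sup>L (pos_part_measure (\<lambda>A. - \<mu> A)) g"

text \<open>
  \<open>measure_of\<close> yields the zero measure when its argument is not countably additive;
  \<open>emeasure_pos_part_measure\<close> below shows that this never happens for a signed Borel measure.
\<close>

lemma sets_pos_part_measure [simp, measurable_cong]: "sets (pos_part_measure \<mu>) = sets borel"
  by (simp add: pos_part_measure_def sigma_algebra.sigma_sets_eq[OF sets.sigma_algebra_axioms[of borel, simplified]])

lemma space_pos_part_measure [simp]: "space (pos_part_measure \<mu>) = UNIV"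
  by (simp add: pos_part_measure_def)

lemma signed_borel_measure_uminus:
  "signed_borel_measure \<mu> \<Longrightarrow> signed_borel_measure (\<lambda>A. - \<mu> A)"
  by (auto simp: signed_borel_measure_def intro!: sums_minus)

lemma signed_borel_measure_Un:
  assumes "signed_borel_measure \<mu>" "A \<in> sets borel" "B \<in> sets borel" "A \<inter> B = {}"
  shows "\<mu> (A \<union> B) = \<mu> A + \<mu> B"
proof -
  have "range (binaryset A B) \<subseteq> sets borel" "disjoint_family (binaryset A B)"
    using assms by (auto simp: range_binaryset_eq disjoint_family_on_def binaryset_def)
  then have "(\<lambda>i. \<mu> (binaryset A B i)) sums \<mu> (A \<union> B)"
    using assms(1) unfolding signed_borel_measure_def UN_binaryset_eq[symmetric] by blast
  moreover have "(\<lambda>i. \<mu> (binaryset A B i)) sums (\<mu> A + \<mu> B)"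
    using assms(1) by (intro binaryset_sums) (simp add: signed_borel_measure_def)
  ultimately show ?thesis by (rule sums_unique2)
qed

lemma pos_part_value_upper:
  "B \<in> sets borel \<Longrightarrow> B \<subseteq> A \<Longrightarrow> ennreal (\<mu> B) \<le> pos_part_value \<mu> A"
  unfolding pos_part_value_def by (rule SUP_upper) auto

lemma pos_part_value_Un:
  assumes "signed_borel_measure \<mu>" "A \<inter> C = {}"
  shows "pos_part_value \<mu> A + pos_part_value \<mu> C \<le> pos_part_value \<mu> (A \<union> C)"
proof -
  have *: "ennreal (\<mu> B) + ennreal (\<mu> D) \<le> pos_part_value \<mu> (A \<union> C)"
    if B: "B \<in> sets borel" "B \<subseteq> A" and D: "D \<in> sets borel" "D \<subseteq> C" for B D
  proof (cases "\<mu> B \<ge> 0 \<and> \<mu> D \<ge> 0")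
    case True
    have "B \<inter> D = {}" using B D assms by auto
    then have "\<mu> (B \<union> D) = \<mu> B + \<mu> D"
      using signed_borel_measure_Un assms(1) B D by blast
    then show ?thesis
      using True pos_part_value_upper[of "B \<union> D" "A \<union> C" \<mu>] B D by auto
  next
    case False
    then show ?thesis
      using pos_part_value_upper[OF B(1) le_supI1[OF B(2)]] pos_part_value_upper[OF D(1) le_supI2[OF D(2)]]
      by (auto simp: ennreal_neg not_le)
  qed
  have ne: "{B \<in> sets (borel :: real measure). B \<subseteq> S} \<noteq> {}" for S
    using sets.empty_sets[of borel] by blast
  have add_le: "pos_part_value \<mu> S + c \<le> R"
    if "\<And>B. B \<in> sets borel \<Longrightarrow> B \<subseteq> S \<Longrightarrow> ennreal (\<mu> B) + c \<le> R" for S c R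
    unfolding pos_part_value_def ennreal_SUP_add_left[OF ne, symmetric]
    using that by (intro SUP_least) auto
  show ?thesis
  proof (rule add_le)
    fix B assume B: "B \<in> sets borel" "B \<subseteq> A"
    show "ennreal (\<mu> B) + pos_part_value \<mu> C \<le> pos_part_value \<mu> (A \<union> C)"
      by (subst add.commute, rule add_le, subst add.commute, rule *[OF B])
  qed
qed

lemma ennreal_sums_le:
  fixes x :: "nat \<Rightarrow> real"
  assumes "x sums s"
  shows "ennreal s \<le> (\<Sum>i. ennreal (x i))"
proof (cases "(\<Sum>i. ennreal (x i)) = top")
  case False
  define y where "y i = max 0 (x i)" for i
  have eq: "ennreal (x i) = ennreal (y i)" for i
    by (simp add: y_def max_def ennreal_neg)
  have y: "summable y"
    using False unfolding eq by (intro summable_suminf_not_top) (auto simp: y_def)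
  have "s \<le> suminf y"
    by (rule sums_le[OF _ assms summable_sums[OF y]]) (simp add: y_def)
  then show ?thesis
    unfolding eq by (subst suminf_ennreal2[OF _ y]) (simp_all add: y_def ennreal_leI)
qed simp

lemma countably_additive_pos_part_value:
  assumes "signed_borel_measure \<mu>"
  shows "countably_additive (sets borel) (pos_part_value \<mu>)"
proof (rule countably_additiveI)
  fix A :: "nat \<Rightarrow> real set"
  assume A: "range A \<subseteq> sets borel" "disjoint_family A"
  have 1: "(\<Sum>i<n. pos_part_value \<mu> (A i)) \<le> pos_part_value \<mu> (\<Union>i<n. A i)" for n
  proof (induction n)
    case (Suc n)
    have "(\<Union>i<n. A i) \<inter> A n = {}"
    proof (rule ccontr)
      assume "(\<Union>i<n. A i) \<inter> A n \<noteq> {}"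
      then obtain x i where "i < n" "x \<in> A i" "x \<in> A n" by blast
      moreover have "A i \<inter> A n = {}" if "i \<noteq> n"
        using disjoint_family_onD[OF A(2) UNIV_I UNIV_I that] .
      ultimately show False by blast
    qed
    note le = pos_part_value_Un[OF assms this]
    have "(\<Sum>i<Suc n. pos_part_value \<mu> (A i)) \<le> pos_part_value \<mu> (\<Union>i<n. A i) + pos_part_value \<mu> (A n)"
      using Suc by (simp add: add_right_mono)
    also note le
    also have "(\<Union>i<n. A i) \<union> A n = (\<Union>i<Suc n. A i)"
      by (auto simp: lessThan_Suc)
    finally show ?case .
  qed simp
  have 2: "pos_part_value \<mu> (\<Union>i<n. A i) \<le> pos_part_value \<mu> (\<Union>i. A i)" for n
    unfolding pos_part_value_def by (rule SUP_subset_mono) auto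
  have "(\<Sum>i. pos_part_value \<mu> (A i)) \<le> pos_part_value \<mu> (\<Union>i. A i)"
    unfolding suminf_eq_SUP by (rule SUP_least) (rule order_trans[OF 1 2])
  moreover have "pos_part_value \<mu> (\<Union>i. A i) \<le> (\<Sum>i. pos_part_value \<mu> (A i))"
    unfolding pos_part_value_def[of \<mu> "\<Union>i. A i"]
  proof (rule SUP_least, clarify)
    fix B assume B: "B \<in> sets borel" "B \<subseteq> (\<Union>i. A i)"
    have r: "range (\<lambda>i. B \<inter> A i) \<subseteq> sets borel"
      using A(1) B(1) by blast
    have d: "disjoint_family (\<lambda>i. B \<inter> A i)"
      by (rule disjoint_family_on_bisimulation[OF A(2)]) blast
    have "(\<Union>i. B \<inter> A i) = B" using B by auto
    moreover have "(\<lambda>i. \<mu> (B \<inter> A i)) sums \<mu> (\<Union>i. B \<inter> A i)"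
      using assms r d unfolding signed_borel_measure_def by blast
    ultimately have "(\<lambda>i. \<mu> (B \<inter> A i)) sums \<mu> B" by simp
    then have "ennreal (\<mu> B) \<le> (\<Sum>i. ennreal (\<mu> (B \<inter> A i)))"
      by (rule ennreal_sums_le)
    also have "\<dots> \<le> (\<Sum>i. pos_part_value \<mu> (A i))"
      using r by (intro suminf_le pos_part_value_upper) auto
    finally show "ennreal (\<mu> B) \<le> (\<Sum>i. pos_part_value \<mu> (A i))" .
  qed
  ultimately show "(\<Sum>i. pos_part_value \<mu> (A i)) = pos_part_value \<mu> (\<Union>i. A i)"
    by (rule antisym)
qed

lemma emeasure_pos_part_measure:
  assumes "signed_borel_measure \<mu>" "A \<in> sets borel"
  shows "emeasure (pos_part_measure \<mu>) A = pos_part_value \<mu> A"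
proof (rule emeasure_measure_of[OF pos_part_measure_def])
  have "{B. B \<in> sets borel \<and> B \<subseteq> {}} = {{} :: real set}" by auto
  then show "positive (sets (pos_part_measure \<mu>)) (pos_part_value \<mu>)"
    using assms by (simp add: positive_def pos_part_value_def signed_borel_measure_def)
  show "countably_additive (sets (pos_part_measure \<mu>)) (pos_part_value \<mu>)"
    using countably_additive_pos_part_value[OF assms(1)] by simp
qed (use assms in auto)


section \<open>Mean-periodic functions\<close>

definition mean_periodic :: "(real \<Rightarrow> complex) \<Rightarrow> bool" where
  "mean_periodic f \<longleftrightarrow>
     continuous_on UNIV f \<and>
     (\<exists>\<mu>. signed_borel_measure \<mu> \<and> nonzero_measure \<mu> \<and> compactly_supported_measure \<mu> \<and>
          (\<forall>x. signed_integral \<mu> (\<lambda>t. f (x - t)) = 0))"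

end

theory Submission
  imports Defs
begin

text \<open>
  Choose \<open>v\<^sub>1\<close> so that the numbers \<open>t\<^sub>j = v\<^sub>1 \<bullet> x\<^sub>j\<close> are distinct. If the vectors
  \<open>(\<sigma>(t\<^sub>j + b))\<^sub>j\<close>, \<open>b \<in> \<real>\<close>, did not span \<open>\<real>\<^sup>M\<close>, some \<open>a \<noteq> 0\<close> would be orthogonal to all of
  them, and the discrete measure with mass \<open>a\<^sub>j\<close> at \<open>-t\<^sub>j\<close> would annihilate \<open>\<sigma>\<close>. So \<open>M\<close> of
  these vectors form a basis, and \<open>u\<^sub>1 = 1\<close> works.
\<close>

definition discrete_measure :: "('a::finite \<Rightarrow> real) \<Rightarrow> ('a \<Rightarrow> real) \<Rightarrow> real set \<Rightarrow> real" where
  "discrete_measure a s A = (\<Sum>j\<in>UNIV. a j * indicator A (s j))"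

text \<open>For a fixed point, the indicator is countably additive in the set, and finite linear
  combinations preserve this.\<close>

lemma signed_borel_measure_discrete: "signed_borel_measure (discrete_measure a s)"
  unfolding signed_borel_measure_def discrete_measure_def
  by (intro conjI allI impI sums_sum sums_mult indicator_sums)
    (simp_all add: disjoint_family_on_def)

lemma discrete_measure_singleton:
  assumes "inj s"
  shows "discrete_measure a s {s j} = a j"
proof -
  have "discrete_measure a s {s j} = (\<Sum>i\<in>UNIV. if i = j then a i else 0)"
    unfolding discrete_measure_def
    by (rule sum.cong) (auto simp: indicator_def inj_eq[OF assms])
  then show ?thesis by simp
qed

lemma compactly_supported_discrete_measure:
  "compactly_supported_measure (discrete_measure a s)"
  unfolding compactly_supported_measure_def discrete_measure_def
  by (rule exI[of _ "range s"]) (auto simp: finite_imp_compact indicator_def intro!: sum.neutral)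

text \<open>The supremum is attained by keeping exactly the atoms in \<open>A\<close> of positive
  mass. As \<open>s\<close> is injective, no two masses share a point, so none can cancel;
  \<open>ennreal\<close> sends the negative masses to 0.\<close>

lemma pos_part_value_discrete_measure:
  assumes "inj s"
  shows "pos_part_value (discrete_measure a s) A = (\<Sum>j\<in>s -` A. ennreal (a j))"
proof (rule antisym)
  show "pos_part_value (discrete_measure a s) A \<le> (\<Sum>j\<in>s -` A. ennreal (a j))"
    unfolding pos_part_value_def
  proof (rule SUP_least, clarify)
    fix B assume B: "B \<subseteq> A"
    have "discrete_measure a s B = (\<Sum>j\<in>s -` B. a j)"
      unfolding discrete_measure_def
      by (intro sum.mono_neutral_cong_right) (auto simp: indicator_def)
    also have "\<dots> \<le> (\<Sum>j\<in>s -` B. max 0 (a j))"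
      by (intro sum_mono) auto
    also have "\<dots> \<le> (\<Sum>j\<in>s -` A. max 0 (a j))"
      using B by (intro sum_mono2) auto
    finally have "ennreal (discrete_measure a s B) \<le> ennreal (\<Sum>j\<in>s -` A. max 0 (a j))"
      by (rule ennreal_leI)
    also have "\<dots> = (\<Sum>j\<in>s -` A. ennreal (max 0 (a j)))"
      by (simp add: sum_ennreal)
    also have "\<dots> = (\<Sum>j\<in>s -` A. ennreal (a j))"
      by (intro sum.cong) (auto simp: max_def ennreal_neg)
    finally show "ennreal (discrete_measure a s B) \<le> (\<Sum>j\<in>s -` A. ennreal (a j))" .
  qed
  define P where "P = {j. s j \<in> A \<and> a j > 0}"
  have "(\<Sum>j\<in>s -` A. ennreal (a j)) = (\<Sum>j\<in>P. ennreal (a j))"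
    by (intro sum.mono_neutral_right) (auto simp: P_def ennreal_neg not_less)
  also have "\<dots> = ennreal (\<Sum>j\<in>P. a j)"
    by (intro sum_ennreal) (auto simp: P_def)
  also have "(\<Sum>j\<in>P. a j) = discrete_measure a s (s ` P)"
    unfolding discrete_measure_def
    by (intro sum.mono_neutral_cong_left) (auto simp: indicator_def inj_image_mem_iff[OF assms])
  also have "ennreal (discrete_measure a s (s ` P)) \<le> pos_part_value (discrete_measure a s) A"
    by (rule pos_part_value_upper) (auto simp: P_def intro!: borel_closed finite_imp_closed)
  finally show "(\<Sum>j\<in>s -` A. ennreal (a j)) \<le> pos_part_value (discrete_measure a s) A" .
qed

text \<open>Writing the positive part as the image of a weighted point measure reduces integrals
  against it to finite sums.\<close>

lemma pos_part_measure_discrete_measure: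
  assumes "inj s"
  shows "pos_part_measure (discrete_measure a s) =
    distr (point_measure UNIV (\<lambda>j. ennreal (a j))) borel s"
  by (rule measure_eqI)
    (simp_all add: emeasure_pos_part_measure[OF signed_borel_measure_discrete]
      pos_part_value_discrete_measure[OF assms] emeasure_distr emeasure_point_measure_finite
      space_point_measure)

lemma integral_pos_part_discrete_measure:
  fixes g :: "real \<Rightarrow> complex"
  assumes "inj s" "g \<in> borel_measurable borel"
  shows "integral\<^sup>L (pos_part_measure (discrete_measure a s)) g =
    (\<Sum>j\<in>UNIV. complex_of_real (max 0 (a j)) * g (s j))"
proof -
  \<comment> \<open>The finite-sum formula for point measures needs nonnegative real weights, so the
    clipping done by \<open>ennreal\<close> is made explicit.\<close>
  have "ennreal (a j) = ennreal (max 0 (a j))" for j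
    by (simp add: max_def ennreal_neg)
  then have "integral\<^sup>L (pos_part_measure (discrete_measure a s)) g =
      integral\<^sup>L (point_measure UNIV (\<lambda>j. ennreal (max 0 (a j)))) (\<lambda>j. g (s j))"
    using assms by (simp add: pos_part_measure_discrete_measure integral_distr)
  also have "\<dots> = (\<Sum>j\<in>UNIV. max 0 (a j) *\<^sub>R g (s j))"
    by (rule lebesgue_integral_point_measure_finite) auto
  finally show ?thesis by (simp add: scaleR_conv_of_real)
qed

text \<open>Negating the measure negates its weights, so the two Jordan parts carry the weights
  \<open>max 0 (a j)\<close> and \<open>max 0 (- a j)\<close>, whose difference is
  \<open>a j\<close>.\<close>

lemma signed_integral_discrete_measure:
  assumes "inj s" "g \<in> borel_measurable borel"
  shows "signed_integral (discrete_measure a s) g = (\<Sum>j\<in>UNIV. complex_of_real (a j) * g (s j))"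
proof -
  have neg: "(\<lambda>A. - discrete_measure a s A) = discrete_measure (\<lambda>j. - a j) s"
    by (simp add: discrete_measure_def fun_eq_iff sum_negf)
  have "max 0 r - max 0 (- r) = r" for r :: real
    by (simp add: max_def)
  then have r: "complex_of_real (max 0 r) - complex_of_real (max 0 (- r)) = complex_of_real r" for r
    by (metis of_real_diff)
  show ?thesis
    unfolding signed_integral_def neg integral_pos_part_discrete_measure[OF assms]
      sum_subtractf[symmetric] left_diff_distrib[symmetric] r ..
qed

lemma mean_periodic_if_translates_dependent:
  fixes \<sigma> :: "real \<Rightarrow> real" and a t :: "'a::finite \<Rightarrow> real"
  assumes cont: "continuous_on UNIV \<sigma>" and "inj t" and "a k \<noteq> 0"
    and 0: "\<And>b. (\<Sum>j\<in>UNIV. a j * \<sigma> (t j + b)) = 0"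
  shows "mean_periodic (\<lambda>x. complex_of_real (\<sigma> x))"
proof -
  \<comment> \<open>The sign turns the convolution argument \<open>x - s j\<close> into
    \<open>t j + x\<close>.\<close>
  define s where "s j = - t j" for j
  have s: "inj s"
    using \<open>inj t\<close> by (auto simp: s_def inj_def)
  let ?\<mu> = "discrete_measure a s"
  have "nonzero_measure ?\<mu>"
    unfolding nonzero_measure_def
    using \<open>a k \<noteq> 0\<close> discrete_measure_singleton[OF s] by (intro bexI[of _ "{s k}"]) auto
  moreover have "signed_integral ?\<mu> (\<lambda>y. complex_of_real (\<sigma> (x - y))) = 0" for x
  proof -
    have "(\<lambda>y. complex_of_real (\<sigma> (x - y))) \<in> borel_measurable borel"
      by (intro borel_measurable_continuous_onI continuous_intros
          continuous_on_compose2[OF cont]) auto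
    then have "signed_integral ?\<mu> (\<lambda>y. complex_of_real (\<sigma> (x - y)))
        = complex_of_real (\<Sum>j\<in>UNIV. a j * \<sigma> (t j + x))"
      by (simp add: signed_integral_discrete_measure[OF s] s_def add.commute)
    then show ?thesis by (simp add: 0)
  qed
  ultimately show ?thesis
    unfolding mean_periodic_def
    using signed_borel_measure_discrete compactly_supported_discrete_measure cont
    by (blast intro: continuous_on_of_real)
qed

text \<open>A vector fails to separate \<open>x i\<close> from \<open>x j\<close> only on the
  hyperplane normal to \<open>x i - x j\<close>, which is nonzero by injectivity. Finitely many
  hyperplanes form a null set and cannot fill the space.\<close>

lemma exists_inner_separating:
  fixes x :: "'a::finite \<Rightarrow> 'b::euclidean_space"
  assumes "inj x"
  obtains v where "inj (\<lambda>j. v \<bullet> x j)"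
proof -
  let ?H = "\<Union>(i, j)\<in>{(i, j). i \<noteq> j}. {v. (x i - x j) \<bullet> v = 0}"
  have "negligible ?H"
    using assms by (intro negligible_Union) (auto simp: inj_eq intro!: negligible_hyperplane)
  then have "?H \<noteq> UNIV"
    using non_negligible_UNIV by metis
  then obtain v where v: "v \<notin> ?H" by blast
  have "inj (\<lambda>j. v \<bullet> x j)"
  proof (rule injI, rule ccontr)
    fix i j assume "v \<bullet> x i = v \<bullet> x j" "i \<noteq> j"
    then show False
      using v by (auto simp: inner_diff_right inner_commute[of _ v])
  qed
  then show ?thesis by (rule that)
qed

text \<open>A basis can be extracted from the spanning set \<open>range w\<close>. It has as many
  elements as the index type \<open>'n\<close>, so a bijection relabels it by \<open>'n\<close>, and
  each basis vector is pulled back to a parameter \<open>b i\<close>.\<close>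

lemma spanning_range_combination:
  fixes w :: "'b \<Rightarrow> 'a::euclidean_space"
  assumes "span (range w) = UNIV" and card: "CARD('n::finite) = DIM('a)"
  obtains b :: "'n::finite \<Rightarrow> 'b" and c :: "'n \<Rightarrow> real"
    where "z = (\<Sum>i\<in>UNIV. c i *\<^sub>R w (b i))"
proof -
  obtain B where B: "B \<subseteq> range w" "independent B" "range w \<subseteq> span B"
    using maximal_independent_subset[of "range w"] by blast
  have sp: "span B = UNIV"
    using B(3) assms(1) by (metis span_mono span_span top.extremum_unique)
  have fin: "finite B" and "card B = DIM('a)"
    using B(2) sp independent_imp_finite basis_card_eq_dim[of B UNIV] by (auto simp: dim_UNIV)
  then obtain f :: "'n \<Rightarrow> 'a" where f: "bij_betw f UNIV B"
    using card finite_same_card_bij[of "UNIV :: 'n set" B] by auto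
  have "\<forall>i. \<exists>b. w b = f i"
    using B(1) f by (metis (no_types) UNIV_I bij_betwE imageE subsetD)
  then obtain b where b: "\<And>i. w (b i) = f i" by metis
  obtain u where "z = (\<Sum>v\<in>B. u v *\<^sub>R v)"
    using sp span_finite[OF fin] by blast
  also have "\<dots> = (\<Sum>i\<in>UNIV. u (f i) *\<^sub>R w (b i))"
    unfolding b by (rule sum.reindex_bij_betw[OF f, symmetric])
  finally show ?thesis by (rule that)
qed

theorem theorem1:
  fixes X :: "real^'m^'d" and Z :: "real^'m^1" and \<sigma> :: "real \<Rightarrow> real"
  assumes "\<And>i j. i \<noteq> j \<Longrightarrow> column i X \<noteq> column j X"
    and "continuous_on UNIV \<sigma>"
    and "\<not> mean_periodic (\<lambda>x. complex_of_real (\<sigma> x))"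
    and "CARD('n) = CARD('m)"
  shows "\<exists>(u1 :: real^'n) (v1 :: real^'d) (b1 :: real^'n) (v2 :: real^'n).
    (rowvector v2 :: real^'n^1) **
      map_matrix \<sigma> ((columnvector u1 :: real^1^'n) ** (rowvector v1 :: real^'d^1) ** X
                     + (columnvector b1 :: real^1^'n) ** (rowvector 1 :: real^'m^1)) = Z"
proof -
  have "inj (\<lambda>j. column j X)"
    using assms(1) by (meson injI)
  then obtain v where v: "inj (\<lambda>j. v \<bullet> column j X)"
    by (rule exists_inner_separating)
  \<comment> \<open>\<open>w b\<close> collects the outputs, over all data points, of a hidden
    neuron with input weight 1 and bias \<open>b\<close>.\<close>
  define w :: "real \<Rightarrow> real^'m" where "w b = (\<chi> j. \<sigma> (v \<bullet> column j X + b))" for b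
  have "span (range w) = UNIV"
  proof (rule ccontr)
    assume "span (range w) \<noteq> UNIV"
    then obtain a where a: "a \<noteq> 0" "\<forall>x\<in>span (range w). a \<bullet> x = 0"
      using span_not_UNIV_orthogonal by blast
    then obtain k where "a $ k \<noteq> 0"
      by (auto simp: vec_eq_iff)
    moreover have "(\<Sum>j\<in>UNIV. a $ j * \<sigma> (v \<bullet> column j X + b)) = 0" for b
    proof -
      have "a \<bullet> w b = 0"
        using a(2) by (simp add: span_base)
      then show ?thesis by (simp add: inner_vec_def w_def)
    qed
    ultimately show False
      using mean_periodic_if_translates_dependent[OF assms(2) v, of "($) a"] assms(3) by blast
  qed
  \<comment> \<open>The only row of \<open>Z\<close> is expanded: \<open>b\<close> supplies the
    biases and \<open>c\<close> the output weights.\<close>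
  then obtain b c where Z: "Z $ 1 = (\<Sum>i::'n\<in>UNIV. c i *\<^sub>R w (b i))"
    by (rule spanning_range_combination[where 'n = 'n]) (simp add: assms(4))
  \<comment> \<open>With the all-ones vector as \<open>u1\<close>, row \<open>i\<close> of the
    hidden layer is \<open>w (b i)\<close>, so comparing entries gives the expansion above.\<close>
  have "(rowvector (\<chi> i. c i) :: real^'n^1) **
      map_matrix \<sigma> ((columnvector 1 :: real^1^'n) ** (rowvector v :: real^'d^1) ** X
                     + (columnvector (\<chi> i. b i) :: real^1^'n) ** (rowvector 1 :: real^'m^1)) = Z"
    using Z by (simp add: vec_eq_iff forall_1 matrix_matrix_mult_def rowvector_def columnvector_def
        map_matrix_def w_def inner_vec_def column_def)
  then show ?thesis by blast
qed

end
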